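(* Let $p\ge q>1$ be integers and let $H$ be a finite family of $d$-intervals satisfying the $(p,q)$ property. Then $$\tau^*(H)\le \max\Big\{\frac{2^{\frac{1}{q-1}}(ep)^\frac{q}{q-1}}{q}\, d^{\frac{1}{q-1}} + 1,~ 2p^2\Big\}.$$
   Context: A $d$-interval is a union of at most $d$ disjoint closed intervals on the real line. A family of sets satisfies the $(p,q)$ property if among any $p$ members of it some $q$ have a common point. $\tau^*(H)$ is the fractional covering number: the minimum of $\sum_x g(x)$ over nonnegative finitely supported functions $g$ on $\mathbb{R}$ with $\sum_{x\in h}g(x)\ge1$ for every $h\in H$. Here $e$ is Euler's number. *)

theory Defs
  imports "HOL-Analysis.Analysis"
begin

text \<open>Closed intervals may be degenerate or unbounded, but are nonempty. At least one of them is
  required: an empty member could not be covered by any weight function.\<close>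

definition d_interval :: "nat \<Rightarrow> real set \<Rightarrow> bool" where
  "d_interval d h \<longleftrightarrow>
     (\<exists>C. finite C \<and> C \<noteq> {} \<and> card C \<le> d \<and> disjoint C \<and>
          (\<forall>I\<in>C. is_interval I \<and> closed I \<and> I \<noteq> {}) \<and> h = \<Union>C)"

definition pq_property :: "nat \<Rightarrow> nat \<Rightarrow> 'a set set \<Rightarrow> bool" where
  "pq_property p q H \<longleftrightarrow>
     (\<forall>F\<subseteq>H. finite F \<and> card F = p \<longrightarrow> (\<exists>G\<subseteq>F. card G = q \<and> \<Inter>G \<noteq> {}))"

definition fractional_cover :: "real set set \<Rightarrow> (real \<Rightarrow> real) \<Rightarrow> bool" where
  "fractional_cover H g \<longleftrightarrow>
     (\<forall>x. g x \<ge> 0) \<and> finite {x. g x \<noteq> 0} \<and>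
     (\<forall>h\<in>H. (\<Sum>x\<in>{x\<in>h. g x \<noteq> 0}. g x) \<ge> 1)"

text \<open>For a finite family of nonempty sets this infimum is the optimum of a feasible finite linear
  program, hence a minimum. If some member is empty there is no fractional cover and the value is
  meaningless.\<close>

definition tau_star :: "real set set \<Rightarrow> real" where
  "tau_star H = (INF g\<in>{g. fractional_cover H g}. \<Sum>x\<in>{x. g x \<noteq> 0}. g x)"

end

theory Submission
  imports Defs
begin

text \<open>By linear programming duality it suffices to bound the total weight \<open>T\<close> of a fractional
  matching. Normalise it to a probability measure on \<open>H\<close> and draw \<open>p\<close> independent members. If
  \<open>T > 2 p\<^sup>2\<close>, two of them coincide with probability at most \<open>1/2\<close>; otherwise some \<open>q\<close> of them meet.
  Members that meet do so at the left endpoint of a component of one of them, and each point is in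
  a random member with probability at most \<open>1/T\<close>, so \<open>q\<close> given draws meet with probability at most
  \<open>q d / T^(q-1)\<close>. Hence \<open>1/2 \<le> (p choose q) q d / T^(q-1)\<close>.\<close>

section \<open>Linear programming duality\<close>

text \<open>Bartl's algebraic proof by induction on the number of inequalities: a violating vector for the
  first inequalities is used to project the last one away.\<close>

lemma farkas:
  fixes a :: "'i \<Rightarrow> 'j \<Rightarrow> real" and c :: "'j \<Rightarrow> real"
  assumes "finite I" "finite J"
    and "\<And>x. (\<forall>i\<in>I. (\<Sum>j\<in>J. a i j * x j) \<le> 0) \<Longrightarrow> (\<Sum>j\<in>J. c j * x j) \<le> 0"
  shows "\<exists>l. (\<forall>i\<in>I. l i \<ge> 0) \<and> (\<forall>j\<in>J. c j = (\<Sum>i\<in>I. l i * a i j))"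
  using assms(1,3)
proof (induction I arbitrary: a c rule: finite_induct)
  case empty
  have "(\<Sum>j\<in>J. c j * c j) \<le> 0"
    using empty by blast
  then have "(\<Sum>j\<in>J. c j * c j) = 0"
    by (meson order_antisym sum_nonneg zero_le_square)
  then show ?case
    using assms(2) by (simp add: sum_nonneg_eq_0_iff)
next
  case (insert m I)
  show ?case
  \<comment> \<open>If the inequalities of \<open>I\<close> already imply the conclusion,
    \<open>m\<close> gets multiplier 0.\<close>
  proof (cases "\<forall>x. (\<forall>i\<in>I. (\<Sum>j\<in>J. a i j * x j) \<le> 0) \<longrightarrow> (\<Sum>j\<in>J. c j * x j) \<le> 0")
    case True
    then obtain l where l: "\<forall>i\<in>I. l i \<ge> 0" "\<forall>j\<in>J. c j = (\<Sum>i\<in>I. l i * a i j)"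
      using insert.IH[of a c] by blast
    show ?thesis
    proof (intro exI[of _ "l(m := 0)"] conjI ballI)
      show "(l(m := 0)) i \<ge> 0" if "i \<in> insert m I" for i
        using that l(1) by auto
      show "c j = (\<Sum>i\<in>insert m I. (l(m := 0)) i * a i j)" if "j \<in> J" for j
      proof -
        have "(\<Sum>i\<in>I. (l(m := 0)) i * a i j) = (\<Sum>i\<in>I. l i * a i j)"
          using insert.hyps by (intro sum.cong) auto
        then show ?thesis
          using insert.hyps l(2) that by simp
      qed
    qed
  next
    case False
    then obtain x where x: "\<forall>i\<in>I. (\<Sum>j\<in>J. a i j * x j) \<le> 0" "(\<Sum>j\<in>J. c j * x j) > 0"
      by force
    define s where "s = (\<Sum>j\<in>J. a m j * x j)"
    \<comment> \<open>The vector \<open>x\<close> satisfies the inequalities of \<open>I\<close> but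
      not the conclusion, so it must violate inequality \<open>m\<close>.\<close>
    have s: "s > 0"
      using insert.prems[of x] x unfolding s_def by force
    \<comment> \<open>Scaled so that \<open>a m\<close> takes the value 1 at \<open>z\<close>; then
      subtracting \<open>a m\<close> of \<open>y\<close> times \<open>z\<close> projects
      \<open>y\<close> along \<open>z\<close> onto the kernel of \<open>a m\<close>.\<close>
    define z where "z j = x j / s" for j
    have scale: "(\<Sum>j\<in>J. b j * z j) = (\<Sum>j\<in>J. b j * x j) / s" for b
      by (simp add: z_def sum_divide_distrib)
    define \<alpha> where "\<alpha> i = (\<Sum>j\<in>J. a i j * z j)" for i
    define \<gamma> where "\<gamma> = (\<Sum>j\<in>J. c j * z j)"
    have \<alpha>m: "\<alpha> m = 1"
      using s scale[of "a m"] by (simp add: \<alpha>_def s_def)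
    have \<alpha>: "\<alpha> i \<le> 0" if "i \<in> I" for i
      using that s x(1) by (simp add: \<alpha>_def scale divide_le_0_iff)
    have \<gamma>: "\<gamma> \<ge> 0"
      using s x(2) by (simp add: \<gamma>_def scale)
    \<comment> \<open>The two sides are adjoint to each other: projecting the functional
      \<open>b\<close> amounts to projecting its argument \<open>y\<close>.\<close>
    have project: "(\<Sum>j\<in>J. (b j - (\<Sum>j\<in>J. b j * z j) * a m j) * y j)
        = (\<Sum>j\<in>J. b j * (y j - (\<Sum>j\<in>J. a m j * y j) * z j))" for b y
    proof -
      have "(\<Sum>j\<in>J. (b j - \<beta> * a m j) * y j) = (\<Sum>j\<in>J. b j * y j) - \<beta> * (\<Sum>j\<in>J. a m j * y j)" for \<beta>
        by (simp add: algebra_simps sum_subtractf sum_distrib_left)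
      moreover have "(\<Sum>j\<in>J. b j * (y j - \<eta> * z j)) = (\<Sum>j\<in>J. b j * y j) - (\<Sum>j\<in>J. b j * z j) * \<eta>" for \<eta>
        by (simp add: algebra_simps sum_subtractf sum_distrib_left)
      ultimately show ?thesis
        by presburger
    qed
    have "(\<Sum>j\<in>J. (c j - \<gamma> * a m j) * y j) \<le> 0"
      if y: "\<forall>i\<in>I. (\<Sum>j\<in>J. (a i j - \<alpha> i * a m j) * y j) \<le> 0" for y
    proof -
      define y' where "y' j = y j - (\<Sum>j\<in>J. a m j * y j) * z j" for j
      have "(\<Sum>j\<in>J. a i j * y' j) \<le> 0" if "i \<in> I" for i
        using y[rule_format, OF that] project[of "a i" y] by (simp add: y'_def \<alpha>_def)
      moreover have "(\<Sum>j\<in>J. a m j * y' j) = 0"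
        using project[of "a m" y] \<alpha>m by (simp add: y'_def \<alpha>_def)
      ultimately have "(\<Sum>j\<in>J. c j * y' j) \<le> 0"
        using insert.prems[of y'] by simp
      then show ?thesis
        using project[of c y] by (simp add: y'_def \<gamma>_def)
    qed
    then obtain l where l: "\<forall>i\<in>I. l i \<ge> 0"
        "\<forall>j\<in>J. c j - \<gamma> * a m j = (\<Sum>i\<in>I. l i * (a i j - \<alpha> i * a m j))"
      using insert.IH[of "\<lambda>i j. a i j - \<alpha> i * a m j" "\<lambda>j. c j - \<gamma> * a m j"] by blast
    \<comment> \<open>The coefficient of \<open>a m\<close> once the projected identity is expanded;
      the signs of \<gamma> and \<alpha> make it nonnegative.\<close>
    define r where "r = \<gamma> - (\<Sum>i\<in>I. l i * \<alpha> i)"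
    have "(\<Sum>i\<in>I. l i * \<alpha> i) \<le> 0"
      using l(1) \<alpha> by (simp add: sum_nonpos mult_nonneg_nonpos)
    then have r: "r \<ge> 0"
      using \<gamma> by (simp add: r_def)
    show ?thesis
    proof (intro exI[of _ "l(m := r)"] conjI ballI)
      show "(l(m := r)) i \<ge> 0" if "i \<in> insert m I" for i
        using that l(1) r by auto
      show "c j = (\<Sum>i\<in>insert m I. (l(m := r)) i * a i j)" if "j \<in> J" for j
      proof -
        have "(\<Sum>i\<in>I. (l(m := r)) i * a i j) = (\<Sum>i\<in>I. l i * a i j)"
          using insert.hyps by (intro sum.cong) auto
        moreover have "c j = \<gamma> * a m j + (\<Sum>i\<in>I. l i * (a i j - \<alpha> i * a m j))"
          using l(2) that by (simp add: algebra_simps)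
        moreover have "(\<Sum>i\<in>I. l i * (a i j - \<alpha> i * a m j))
            = (\<Sum>i\<in>I. l i * a i j) - (\<Sum>i\<in>I. l i * \<alpha> i) * a m j"
          by (simp add: algebra_simps sum_subtractf sum_distrib_left)
        ultimately show ?thesis
          using insert.hyps by (simp add: r_def algebra_simps)
      qed
    qed
  qed
qed

text \<open>The cover consists of the Farkas multipliers of the packing constraints. The coordinate
  of a member in the Farkas identity yields its covering inequality, and the coordinate
  \<open>None\<close> yields the bound on the total weight. A positive entry in every row keeps
  packings bounded.\<close>

lemma covering_packing_duality:
  fixes M :: "'h \<Rightarrow> 'x \<Rightarrow> real"
  assumes "finite H" "finite P"
    and M: "\<And>h x. \<lbrakk>h \<in> H; x \<in> P\<rbrakk> \<Longrightarrow> M h x \<ge> 0" "\<And>h. h \<in> H \<Longrightarrow> \<exists>x\<in>P. M h x > 0"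
    and B: "\<And>f. \<lbrakk>\<forall>h\<in>H. f h \<ge> 0; \<forall>x\<in>P. (\<Sum>h\<in>H. M h x * f h) \<le> 1\<rbrakk> \<Longrightarrow> (\<Sum>h\<in>H. f h) \<le> B"
  shows "\<exists>g. (\<forall>x\<in>P. g x \<ge> 0) \<and> (\<forall>h\<in>H. (\<Sum>x\<in>P. M h x * g x) \<ge> 1) \<and> (\<Sum>x\<in>P. g x) \<le> B"
proof -
  \<comment> \<open>The bound on packings is homogenised by an extra variable, indexed by \<open>None\<close>, for the right-hand
    side \<open>1\<close>.\<close>
  define I :: "('h + 'x option) set" where "I = H <+> insert None (Some ` P)"
  define J :: "'h option set" where "J = insert None (Some ` H)"
  \<comment> \<open>Rows \<open>Inl h\<close> and \<open>Inr None\<close> encode nonnegativity of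
    \<open>f h\<close> and of the extra variable \<open>t\<close>; row \<open>Inr (Some x)\<close>
    encodes the packing constraint at \<open>x\<close> with right-hand side \<open>t\<close>. The
    functional \<open>c\<close> encodes total weight at most \<open>B * t\<close>.\<close>
  define a :: "'h + 'x option \<Rightarrow> 'h option \<Rightarrow> real" where
    "a i j = (case i of
        Inl h \<Rightarrow> (if j = Some h then -1 else 0)
      | Inr None \<Rightarrow> (if j = None then -1 else 0)
      | Inr (Some x) \<Rightarrow> (case j of None \<Rightarrow> -1 | Some h \<Rightarrow> M h x))" for i j
  define c where "c j = (case j of None \<Rightarrow> - B | Some h \<Rightarrow> 1)" for j :: "'h option"
  have sum_J: "(\<Sum>j\<in>J. u j) = u None + (\<Sum>h\<in>H. u (Some h))" for u :: "'h option \<Rightarrow> real"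
    using assms(1) by (simp add: J_def sum.reindex)
  have sum_I: "(\<Sum>i\<in>I. u i) = (\<Sum>h\<in>H. u (Inl h)) + (u (Inr None) + (\<Sum>x\<in>P. u (Inr (Some x))))"
    for u :: "'h + 'x option \<Rightarrow> real"
    using assms(1,2) by (simp add: I_def sum.Plus sum.reindex)
  have "(\<Sum>j\<in>J. c j * x j) \<le> 0" if x: "\<forall>i\<in>I. (\<Sum>j\<in>J. a i j * x j) \<le> 0" for x
  proof -
    define t f where "t = x None" and "f h = x (Some h)" for h
    have "x (Some h) \<ge> 0" if "h \<in> H" for h
    proof -
      have "(\<Sum>j\<in>J. a (Inl h) j * x j) = - x (Some h)"
        using that assms(1)
        by (simp add: sum_J a_def if_distrib[of "\<lambda>r. r * _"] sum.delta cong: if_cong)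
      moreover have "Inl h \<in> I"
        using that by (auto simp: I_def)
      ultimately show ?thesis
        using x by (metis neg_le_0_iff_le)
    qed
    then have f0: "\<forall>h\<in>H. f h \<ge> 0"
      by (simp add: f_def)
    have "(\<Sum>j\<in>J. a (Inr None) j * x j) = - t"
      by (simp add: sum_J a_def t_def)
    moreover have "Inr None \<in> I"
      by (auto simp: I_def)
    ultimately have t0: "t \<ge> 0"
      using x by (metis neg_le_0_iff_le)
    have f1: "(\<Sum>h\<in>H. M h y * f h) \<le> t" if "y \<in> P" for y
    proof -
      have "(\<Sum>j\<in>J. a (Inr (Some y)) j * x j) = (\<Sum>h\<in>H. M h y * f h) - t"
        by (simp add: sum_J a_def t_def f_def)
      moreover have "Inr (Some y) \<in> I"
        using that by (auto simp: I_def)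
      ultimately show ?thesis
        using x by (metis diff_le_0_iff_le)
    qed
    have "(\<Sum>h\<in>H. f h) \<le> B * t"
    proof (cases "t = 0")
      case True
      \<comment> \<open>Division by \<open>t\<close> is impossible here, but a packing with all
        right-hand sides 0 vanishes because each row has a positive entry.\<close>
      have "f h = 0" if h: "h \<in> H" for h
      proof -
        obtain y where y: "y \<in> P" "M h y > 0"
          using M(2) h by blast
        have "M h y * f h \<le> (\<Sum>h\<in>H. M h y * f h)"
          using h y f0 M(1) assms(1) by (intro member_le_sum) auto
        then have "M h y * f h \<le> 0"
          using f1[OF y(1)] True by simp
        then show ?thesis
          using y(2) f0 h by (simp add: mult_le_0_iff) (meson less_le_not_le order_antisym)
      qed
      then show ?thesis
        using True by simp
    next
      case False
      then have t: "t > 0"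
        using t0 by simp
      have "(\<Sum>h\<in>H. f h / t) \<le> B"
      proof (rule B)
        show "\<forall>h\<in>H. f h / t \<ge> 0"
          using f0 t by simp
        show "\<forall>y\<in>P. (\<Sum>h\<in>H. M h y * (f h / t)) \<le> 1"
          using f1 t by (simp add: sum_divide_distrib[symmetric])
      qed
      then show ?thesis
        using t by (simp add: sum_divide_distrib[symmetric] divide_le_eq)
    qed
    then show ?thesis
      by (simp add: sum_J c_def f_def t_def)
  qed
  moreover have "finite I" "finite J"
    using assms(1,2) by (simp_all add: I_def J_def)
  ultimately obtain l where l: "\<forall>i\<in>I. l i \<ge> 0" "\<forall>j\<in>J. c j = (\<Sum>i\<in>I. l i * a i j)"
    using farkas[of I J a c] by blast
  define g where "g x = l (Inr (Some x))" for x
  show ?thesis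
  proof (intro exI[of _ g] conjI ballI)
    show "g x \<ge> 0" if "x \<in> P" for x
      using l(1) that by (auto simp: g_def I_def)
    show "(\<Sum>x\<in>P. M h x * g x) \<ge> 1" if h: "h \<in> H" for h
    proof -
      have "1 = (\<Sum>i\<in>I. l i * a i (Some h))"
        using l(2)[rule_format, of "Some h"] h by (simp add: J_def c_def)
      also have "\<dots> = - l (Inl h) + (\<Sum>x\<in>P. M h x * g x)"
        using h assms(1)
        by (simp add: sum_I a_def g_def if_distrib[of "\<lambda>r. _ * r"] sum.delta mult.commute cong: if_cong)
      finally have "(\<Sum>x\<in>P. M h x * g x) = 1 + l (Inl h)"
        by simp
      moreover have "Inl h \<in> I"
        using h by (auto simp: I_def)
      ultimately show ?thesis
        using l(1) by simp
    qed
    have "- B = (\<Sum>i\<in>I. l i * a i None)"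
      using l(2)[rule_format, of None] by (simp add: J_def c_def)
    also have "\<dots> = - l (Inr None) - (\<Sum>x\<in>P. g x)"
      by (simp add: sum_I a_def g_def sum_negf)
    finally have "(\<Sum>x\<in>P. g x) = B - l (Inr None)"
      by simp
    moreover have "Inr None \<in> I"
      by (auto simp: I_def)
    ultimately show "(\<Sum>x\<in>P. g x) \<le> B"
      using l(1) by simp
  qed
qed

text \<open>Duality is applied to the incidence matrix of points and members. Points in the same
  members impose the same packing constraint, so finitely many points suffice, and a cover on them
  extends by zero to the line.\<close>

lemma tau_star_le_fractional_matching_bound:
  assumes "finite H" "{} \<notin> H"
    and B: "\<And>f. \<lbrakk>\<forall>h\<in>H. f h \<ge> 0; \<forall>x. (\<Sum>h\<in>{h\<in>H. x \<in> h}. f h) \<le> 1\<rbrakk> \<Longrightarrow> (\<Sum>h\<in>H. f h) \<le> B"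
  shows "tau_star H \<le> B"
proof -
  \<comment> \<open>The line is replaced by finitely many points, one for each set of members through a point.\<close>
  define type where "type x = {h\<in>H. x \<in> h}" for x :: real
  have "finite (range type)"
    using assms(1) by (rule_tac finite_subset[of _ "Pow H"]) (auto simp: type_def)
  then obtain P where P: "finite P" "type ` P = range type"
    by (metis finite_subset_image subset_UNIV order_refl)
  have rep: "\<exists>y\<in>P. type y = type x" for x
    by (metis P(2) imageE rangeI)
  have sum_type: "(\<Sum>h\<in>H. of_bool (x \<in> h) * f h) = (\<Sum>h\<in>type x. f h)" for x and f :: "real set \<Rightarrow> real"
    using assms(1) by (simp add: type_def sum.inter_filter of_bool_def if_distrib[of "\<lambda>r. r * _"] cong: if_cong)
  have "\<exists>g. (\<forall>x\<in>P. g x \<ge> 0) \<and> (\<forall>h\<in>H. (\<Sum>x\<in>P. of_bool (x \<in> h) * g x) \<ge> 1) \<and> (\<Sum>x\<in>P. g x) \<le> B"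
  proof (rule covering_packing_duality)
    show "\<exists>x\<in>P. (of_bool (x \<in> h) :: real) > 0" if h: "h \<in> H" for h
    proof -
      obtain x where "x \<in> h"
        using h assms(2) by (metis ex_in_conv)
      with rep[of x] h show ?thesis
        by (auto simp: type_def)
    qed
    show "(\<Sum>h\<in>H. f h) \<le> B"
      if f: "\<forall>h\<in>H. f h \<ge> 0" "\<forall>x\<in>P. (\<Sum>h\<in>H. of_bool (x \<in> h) * f h) \<le> 1" for f
    proof (rule B[OF f(1)], rule allI)
      fix x
      obtain y where y: "y \<in> P" "type y = type x"
        using rep by blast
      show "(\<Sum>h\<in>{h\<in>H. x \<in> h}. f h) \<le> 1"
        using f(2) y unfolding sum_type type_def by metis
    qed
  qed (use assms(1) P(1) in auto)
  then obtain g where g: "\<forall>x\<in>P. g x \<ge> 0" "\<forall>h\<in>H. (\<Sum>x\<in>P. of_bool (x \<in> h) * g x) \<ge> 1" "(\<Sum>x\<in>P. g x) \<le> B"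
    by blast
  define g' where "g' x = (if x \<in> P then g x else 0)" for x
  have supp: "{x. g' x \<noteq> 0} \<subseteq> P"
    by (auto simp: g'_def)
  have "fractional_cover H g'"
    unfolding fractional_cover_def
  proof (intro conjI allI ballI)
    show "g' x \<ge> 0" for x
      using g(1) by (simp add: g'_def)
    show "finite {x. g' x \<noteq> 0}"
      using supp P(1) finite_subset by blast
    show "(\<Sum>x\<in>{x\<in>h. g' x \<noteq> 0}. g' x) \<ge> 1" if "h \<in> H" for h
    proof -
      have "(\<Sum>x\<in>{x\<in>h. g' x \<noteq> 0}. g' x) = (\<Sum>x\<in>{x\<in>h. g' x \<noteq> 0}. of_bool (x \<in> h) * g x)"
        by (intro sum.cong) (auto simp: g'_def)
      also have "\<dots> = (\<Sum>x\<in>P. of_bool (x \<in> h) * g x)"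
        using P(1) by (intro sum.mono_neutral_left) (auto simp: g'_def)
      finally show ?thesis
        using g(2) that by simp
    qed
  qed
  then have "tau_star H \<le> (\<Sum>x\<in>{x. g' x \<noteq> 0}. g' x)"
    unfolding tau_star_def
    by (intro cINF_lower bdd_belowI2[of _ 0]) (auto simp: fractional_cover_def intro: sum_nonneg)
  also have "\<dots> = (\<Sum>x\<in>P. g x)"
    using P(1) by (intro sum.mono_neutral_cong_left) (auto simp: g'_def)
  finally show ?thesis
    using g(3) by simp
qed

section \<open>Common points of intervals and of d-intervals\<close>

text \<open>A nonempty intersection of finitely many closed intervals, if bounded below, begins at
  the largest left endpoint. The marks are fixed before \<open>G\<close> is chosen, so one point per
  interval serves all subfamilies at once.\<close>

lemma closed_intervals_meet_at_marked_point:
  assumes "finite \<C>" and int: "\<And>I. I \<in> \<C> \<Longrightarrow> is_interval I \<and> closed I \<and> I \<noteq> ({} :: real set)"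
  shows "\<exists>l. \<forall>G\<subseteq>\<C>. G \<noteq> {} \<and> \<Inter>G \<noteq> {} \<longrightarrow> (\<exists>I\<in>G. l I \<in> \<Inter>G)"
proof -
  \<comment> \<open>The mark is the left endpoint; for intervals unbounded below it is a common point far enough to
    the left.\<close>
  define e where "e I = (SOME x. x \<in> I)" for I :: "real set"
  have e: "e I \<in> I" if "I \<in> \<C>" for I
    using int[OF that] by (simp add: e_def some_in_eq)
  define m where "m = Min (e ` \<C>)"
  have m: "m \<le> e I" if "I \<in> \<C>" for I
    using that assms(1) by (simp add: m_def)
  define l where "l I = (if bdd_below I then Inf I else m)" for I :: "real set"
  have "\<exists>I\<in>G. l I \<in> \<Inter>G" if G: "G \<subseteq> \<C>" "G \<noteq> {}" and x: "x \<in> \<Inter>G" for G x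
  proof -
    have finG: "finite G"
      using G(1) assms(1) finite_subset by blast
    \<comment> \<open>An interval unbounded below contains everything to the left of each of its
      points.\<close>
    have left: "y \<in> I" if "I \<in> G" "\<not> bdd_below I" "y \<le> z" "z \<in> I" for I y z
    proof -
      obtain u where "u \<in> I" "u < y"
        using \<open>\<not> bdd_below I\<close> unfolding bdd_below_def by (meson linorder_not_le)
      then show ?thesis
        using int[of I] \<open>I \<in> G\<close> \<open>y \<le> z\<close> \<open>z \<in> I\<close> G(1) mem_is_interval_1_I[of I u z y] by auto
    qed
    define K where "K = {I \<in> G. bdd_below I}"
    show ?thesis
    proof (cases "K = {}")
      case True
      have "m \<in> I" if "I \<in> G" for I
        using left[of I m "e I"] that True e m G(1) by (auto simp: K_def)
      moreover obtain I where "I \<in> G"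
        using G(2) by blast
      ultimately show ?thesis
        using True by (intro bexI[of _ I]) (auto simp: l_def K_def)
    next
      case False
      define s where "s = Max (Inf ` K)"
      have finK: "finite K"
        using finG by (simp add: K_def)
      then have "s \<in> Inf ` K"
        using False by (simp add: s_def)
      then obtain I where I: "I \<in> K" "s = Inf I"
        by blast
      have sx: "s \<le> x"
        using I x by (auto simp: K_def intro: cInf_lower)
      \<comment> \<open>The common point \<open>x\<close> lies to the right of \<open>s\<close>. A
        member bounded below contains the segment from \<open>Inf J\<close> to \<open>x\<close>,
        hence \<open>s\<close>; an unbounded one contains all points left of
        \<open>x\<close>.\<close>
      have "s \<in> J" if J: "J \<in> G" for J
      proof (cases "bdd_below J")
        case True
        then have "Inf J \<in> J"
          using int[of J] J G(1) closed_contains_Inf by auto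
        moreover have "Inf J \<le> s"
          using True J finK by (simp add: s_def K_def)
        ultimately show ?thesis
          using int[of J] J G(1) x sx mem_is_interval_1_I[of J "Inf J" x s] by auto
      next
        case False
        from J x have "x \<in> J"
          by simp
        with False show ?thesis
          by (rule left[OF J _ sx])
      qed
      then show ?thesis
        using I by (intro bexI[of _ I]) (auto simp: l_def K_def)
    qed
  qed
  then show ?thesis
    by (intro exI[of _ l]) blast
qed

text \<open>\<open>L h\<close> collects the marks of the at most \<open>d\<close> components of
  \<open>h\<close>. Given a common point of \<open>G\<close>, the components through it, one per
  member, form a meeting family of intervals, to which the previous lemma applies.\<close>

lemma d_intervals_meet_at_marked_point:
  assumes "finite H" and "\<forall>h\<in>H. d_interval d h"
  obtains L where "\<And>h. h \<in> H \<Longrightarrow> finite (L h) \<and> card (L h) \<le> d"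
    and "\<And>G. \<lbrakk>G \<subseteq> H; G \<noteq> {}; \<Inter>G \<noteq> {}\<rbrakk> \<Longrightarrow> \<exists>h\<in>G. \<exists>y\<in>L h. y \<in> \<Inter>G"
proof -
  obtain C where C: "\<And>h. h \<in> H \<Longrightarrow> finite (C h) \<and> card (C h) \<le> d \<and>
      (\<forall>I\<in>C h. is_interval I \<and> closed I \<and> I \<noteq> {}) \<and> h = \<Union>(C h)"
    using assms(2) unfolding d_interval_def by metis
  have "\<exists>l. \<forall>G\<subseteq>(\<Union>h\<in>H. C h). G \<noteq> {} \<and> \<Inter>G \<noteq> {} \<longrightarrow> (\<exists>I\<in>G. l I \<in> \<Inter>G)"
    using C assms(1) by (intro closed_intervals_meet_at_marked_point) auto
  then obtain l where l: "\<And>G. \<lbrakk>G \<subseteq> (\<Union>h\<in>H. C h); G \<noteq> {}; \<Inter>G \<noteq> {}\<rbrakk> \<Longrightarrow> \<exists>I\<in>G. l I \<in> \<Inter>G"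
    by metis
  show ?thesis
  proof
    show "finite (l ` C h) \<and> card (l ` C h) \<le> d" if "h \<in> H" for h
      using C[OF that] card_image_le[of "C h" l] by auto
    show "\<exists>h\<in>G. \<exists>y\<in>l ` C h. y \<in> \<Inter>G" if G: "G \<subseteq> H" "G \<noteq> {}" "\<Inter>G \<noteq> {}" for G
    proof -
      obtain x where x: "x \<in> \<Inter>G"
        using G(3) by blast
      have "\<exists>I\<in>C h. x \<in> I" if "h \<in> G" for h
      proof -
        have "h = \<Union>(C h)"
          using C G(1) that by blast
        then show ?thesis
          using x that by blast
      qed
      then obtain c where c: "\<And>h. h \<in> G \<Longrightarrow> c h \<in> C h \<and> x \<in> c h"
        by metis
      have "\<exists>I\<in>c ` G. l I \<in> \<Inter>(c ` G)"
      proof (rule l)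
        show "c ` G \<subseteq> (\<Union>h\<in>H. C h)" "c ` G \<noteq> {}"
          using c G by auto
        show "\<Inter>(c ` G) \<noteq> {}"
          using c by blast
      qed
      then obtain h where h: "h \<in> G" "l (c h) \<in> \<Inter>(c ` G)"
        by blast
      have "l (c h) \<in> h'" if "h' \<in> G" for h'
      proof -
        have "h' = \<Union>(C h')"
          using C G(1) that by blast
        then show ?thesis
          using h(2) c that by blast
      qed
      then show ?thesis
        using h(1) c by blast
    qed
  qed
qed

section \<open>Probabilities for independent random members\<close>

text \<open>The left-hand side is the probability that the draws indexed by \<open>Q\<close> have a
  common point, for independent draws with law \<open>w\<close>. There are \<open>card Q\<close>
  choices for the draw carrying the marked point and at most \<open>d\<close> marks on its value;
  each of the other \<open>card Q - 1\<close> draws contains that mark with probability at most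
  \<epsilon>.\<close>

lemma weight_of_intersecting_tuples:
  fixes w :: "'a set \<Rightarrow> real"
  assumes "finite S" "Q \<subseteq> S" "Q \<noteq> {}" "finite H"
    and w: "\<And>h. h \<in> H \<Longrightarrow> w h \<ge> 0" "(\<Sum>h\<in>H. w h) = 1"
    and \<epsilon>: "\<And>x. (\<Sum>h\<in>{h\<in>H. x \<in> h}. w h) \<le> \<epsilon>"
    and L: "\<And>h. h \<in> H \<Longrightarrow> finite (L h) \<and> card (L h) \<le> d"
      "\<And>G. \<lbrakk>G \<subseteq> H; G \<noteq> {}; \<Inter>G \<noteq> {}\<rbrakk> \<Longrightarrow> \<exists>h\<in>G. \<exists>y\<in>L h. y \<in> \<Inter>G"
  shows "(\<Sum>\<phi>\<in>S \<rightarrow>\<^sub>E H. of_bool (\<Inter>(\<phi> ` Q) \<noteq> {}) * (\<Prod>i\<in>S. w (\<phi> i)))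
    \<le> real (card Q) * real d * \<epsilon> ^ (card Q - 1)"
proof -
  \<comment> \<open>Union bound over the draw \<open>k\<close> whose value \<open>h\<close> carries the common marked point \<open>y\<close>; each event
    restricts the draws independently.\<close>
  define u where "u k h y i h' =
      (if i = k then of_bool (h' = h) else if i \<in> Q then of_bool (y \<in> h') else 1) * w h'"
    for k h y i h'
  have finQ: "finite Q"
    using assms(1,2) finite_subset by blast
  have u0: "u k h y i h' \<ge> 0" if "h' \<in> H" for k h y i h'
    using w(1)[OF that] by (simp add: u_def)
  have u0\<phi>: "u k h y i (\<phi> i) \<ge> 0" if "\<phi> \<in> S \<rightarrow>\<^sub>E H" "i \<in> S" for k h y i \<phi>
    using that by (intro u0) auto
  have \<epsilon>0: "\<epsilon> \<ge> 0"
    using \<epsilon>[of undefined] w(1) by (smt (verit, best) mem_Collect_eq sum_nonneg)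
  have "of_bool (\<Inter>(\<phi> ` Q) \<noteq> {}) * (\<Prod>i\<in>S. w (\<phi> i))
      \<le> (\<Sum>k\<in>Q. \<Sum>h\<in>H. \<Sum>y\<in>L h. \<Prod>i\<in>S. u k h y i (\<phi> i))" if \<phi>: "\<phi> \<in> S \<rightarrow>\<^sub>E H" for \<phi>
  proof (cases "\<Inter>(\<phi> ` Q) = {}")
    case True
    then show ?thesis
      using u0\<phi>[OF \<phi>] by (auto intro!: sum_nonneg prod_nonneg)
  next
    case False
    have "\<exists>h\<in>\<phi> ` Q. \<exists>y\<in>L h. y \<in> \<Inter>(\<phi> ` Q)"
      using \<phi> assms(2,3) False by (intro L(2)) auto
    then obtain k y where ky: "k \<in> Q" "y \<in> L (\<phi> k)" "y \<in> \<Inter>(\<phi> ` Q)"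
      by blast
    have kH: "\<phi> k \<in> H"
      using ky(1) \<phi> assms(2) by auto
    have nn: "(\<Prod>i\<in>S. u k h y i (\<phi> i)) \<ge> 0" for k h y
      using u0\<phi>[OF \<phi>] by (auto intro!: prod_nonneg)
    have "(\<Prod>i\<in>S. w (\<phi> i)) = (\<Prod>i\<in>S. u k (\<phi> k) y i (\<phi> i))"
      using ky(3) by (intro prod.cong) (auto simp: u_def)
    also have "\<dots> \<le> (\<Sum>y\<in>L (\<phi> k). \<Prod>i\<in>S. u k (\<phi> k) y i (\<phi> i))"
      using ky(2) nn L(1)[OF kH] by (intro member_le_sum) auto
    also have "\<dots> \<le> (\<Sum>h\<in>H. \<Sum>y\<in>L h. \<Prod>i\<in>S. u k h y i (\<phi> i))"
      using nn kH assms(4)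
      by (intro member_le_sum[where f = "\<lambda>h. \<Sum>y\<in>L h. \<Prod>i\<in>S. u k h y i (\<phi> i)"] sum_nonneg) auto
    also have "\<dots> \<le> (\<Sum>k\<in>Q. \<Sum>h\<in>H. \<Sum>y\<in>L h. \<Prod>i\<in>S. u k h y i (\<phi> i))"
      using nn ky(1) finQ
      by (intro member_le_sum[where f = "\<lambda>k. \<Sum>h\<in>H. \<Sum>y\<in>L h. \<Prod>i\<in>S. u k h y i (\<phi> i)"] sum_nonneg) auto
    finally show ?thesis
      using False by simp
  qed
  then have "(\<Sum>\<phi>\<in>S \<rightarrow>\<^sub>E H. of_bool (\<Inter>(\<phi> ` Q) \<noteq> {}) * (\<Prod>i\<in>S. w (\<phi> i)))
      \<le> (\<Sum>\<phi>\<in>S \<rightarrow>\<^sub>E H. \<Sum>k\<in>Q. \<Sum>h\<in>H. \<Sum>y\<in>L h. \<Prod>i\<in>S. u k h y i (\<phi> i))"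
    by (rule sum_mono)
  also have "\<dots> = (\<Sum>k\<in>Q. \<Sum>h\<in>H. \<Sum>y\<in>L h. \<Sum>\<phi>\<in>S \<rightarrow>\<^sub>E H. \<Prod>i\<in>S. u k h y i (\<phi> i))"
    by (subst sum.swap, rule sum.cong[OF refl], subst sum.swap, rule sum.cong[OF refl], rule sum.swap)
  \<comment> \<open>Independence: a sum of products over all tuples is a product of sums over single
    draws.\<close>
  also have "\<dots> = (\<Sum>k\<in>Q. \<Sum>h\<in>H. \<Sum>y\<in>L h. \<Prod>i\<in>S. \<Sum>h'\<in>H. u k h y i h')"
    using assms(1,4) by (simp add: prod_sum_PiE)
  also have "\<dots> \<le> (\<Sum>k\<in>Q. \<Sum>h\<in>H. \<Sum>y\<in>L h. w h * \<epsilon> ^ (card Q - 1))"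
  proof (intro sum_mono)
    fix k h y
    assume k: "k \<in> Q" and h: "h \<in> H"
    have "(\<Prod>i\<in>S. \<Sum>h'\<in>H. u k h y i h')
        = (\<Sum>h'\<in>H. u k h y k h') * (\<Prod>i\<in>S - {k}. \<Sum>h'\<in>H. u k h y i h')"
      using k assms(1,2) by (intro prod.remove) auto
    also have "(\<Sum>h'\<in>H. u k h y k h') = w h"
      using h assms(4) by (simp add: u_def of_bool_def if_distrib[of "\<lambda>r. r * _"] cong: if_cong)
    also have "(\<Prod>i\<in>S - {k}. \<Sum>h'\<in>H. u k h y i h') \<le> (\<Prod>i\<in>S - {k}. if i \<in> Q then \<epsilon> else 1)"
    proof (intro prod_mono conjI)
      fix i
      assume i: "i \<in> S - {k}"
      show "(\<Sum>h'\<in>H. u k h y i h') \<ge> 0"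
        using u0 by (intro sum_nonneg)
      show "(\<Sum>h'\<in>H. u k h y i h') \<le> (if i \<in> Q then \<epsilon> else 1)"
      proof (cases "i \<in> Q")
        case True
        then have "(\<Sum>h'\<in>H. u k h y i h') = (\<Sum>h'\<in>{h'\<in>H. y \<in> h'}. w h')"
          using i assms(4)
          by (simp add: u_def sum.inter_filter of_bool_def if_distrib[of "\<lambda>r. r * _"] cong: if_cong)
        then show ?thesis
          using True \<epsilon> by simp
      next
        case False
        then show ?thesis
          using i w(2) by (simp add: u_def)
      qed
    qed
    also have "(\<Prod>i\<in>S - {k}. if i \<in> Q then \<epsilon> else 1) = (\<Prod>i\<in>Q - {k}. \<epsilon>)"
      using assms(1,2) by (intro prod.mono_neutral_cong_right) auto
    also have "\<dots> = \<epsilon> ^ (card Q - 1)"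
      using k finQ by simp
    finally show "(\<Prod>i\<in>S. \<Sum>h'\<in>H. u k h y i h') \<le> w h * \<epsilon> ^ (card Q - 1)"
      using w(1)[OF h] by (simp add: mult_left_mono)
  qed
  also have "\<dots> \<le> (\<Sum>k\<in>Q. \<Sum>h\<in>H. real d * (w h * \<epsilon> ^ (card Q - 1)))"
    using w(1) \<epsilon>0 L(1) by (intro sum_mono) (simp add: mult_right_mono)
  also have "\<dots> = real (card Q) * real d * \<epsilon> ^ (card Q - 1)"
    using w(2) by (simp add: sum_distrib_left[symmetric] sum_distrib_right[symmetric])
  finally show ?thesis .
qed

text \<open>Two independent draws both equal \<open>h\<close> with probability
  \<open>w h * w h\<close>, which is at most \<open>\<epsilon> * w h\<close>; summing over
  \<open>h\<close> gives \<epsilon>.\<close>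

lemma weight_of_collision:
  fixes w :: "'a \<Rightarrow> real"
  assumes "finite S" "i \<in> S" "j \<in> S" "i \<noteq> j" "finite H"
    and w: "\<And>h. h \<in> H \<Longrightarrow> 0 \<le> w h \<and> w h \<le> \<epsilon>" "(\<Sum>h\<in>H. w h) = 1"
  shows "(\<Sum>\<phi>\<in>S \<rightarrow>\<^sub>E H. of_bool (\<phi> i = \<phi> j) * (\<Prod>k\<in>S. w (\<phi> k))) \<le> \<epsilon>"
proof -
  define u where "u h k h' = (if k = i \<or> k = j then of_bool (h' = h) else 1) * w h'" for h k h'
  have "of_bool (\<phi> i = \<phi> j) * (\<Prod>k\<in>S. w (\<phi> k)) \<le> (\<Sum>h\<in>H. \<Prod>k\<in>S. u h k (\<phi> k))"
    if \<phi>: "\<phi> \<in> S \<rightarrow>\<^sub>E H" for \<phi>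
  proof -
    have nn: "(\<Prod>k\<in>S. u h k (\<phi> k)) \<ge> 0" for h
    proof (intro prod_nonneg ballI)
      fix k
      assume "k \<in> S"
      then have "\<phi> k \<in> H"
        using \<phi> by auto
      then show "u h k (\<phi> k) \<ge> 0"
        using w(1) by (simp add: u_def)
    qed
    show ?thesis
    proof (cases "\<phi> i = \<phi> j")
      case True
      have "(\<Prod>k\<in>S. w (\<phi> k)) = (\<Prod>k\<in>S. u (\<phi> i) k (\<phi> k))"
        using True by (intro prod.cong) (auto simp: u_def)
      also have "\<dots> \<le> (\<Sum>h\<in>H. \<Prod>k\<in>S. u h k (\<phi> k))"
        using nn \<phi> assms(2,5) by (intro member_le_sum[where f = "\<lambda>h. \<Prod>k\<in>S. u h k (\<phi> k)"]) auto
      finally show ?thesis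
        using True by simp
    qed (use nn in \<open>simp add: sum_nonneg\<close>)
  qed
  then have "(\<Sum>\<phi>\<in>S \<rightarrow>\<^sub>E H. of_bool (\<phi> i = \<phi> j) * (\<Prod>k\<in>S. w (\<phi> k)))
      \<le> (\<Sum>\<phi>\<in>S \<rightarrow>\<^sub>E H. \<Sum>h\<in>H. \<Prod>k\<in>S. u h k (\<phi> k))"
    by (rule sum_mono)
  also have "\<dots> = (\<Sum>h\<in>H. \<Prod>k\<in>S. \<Sum>h'\<in>H. u h k h')"
    using assms(1,5) by (subst sum.swap) (simp add: prod_sum_PiE)
  also have "\<dots> = (\<Sum>h\<in>H. w h * w h)"
  proof (rule sum.cong[OF refl])
    fix h
    assume h: "h \<in> H"
    have sel: "(\<Sum>h'\<in>H. u h k h') = (if k = i \<or> k = j then w h else 1)" for k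
      using h assms(5) w(2)
      by (simp add: u_def of_bool_def if_distrib[of "\<lambda>r. r * _"] cong: if_cong)
    have "(\<Prod>k\<in>S. if k = i \<or> k = j then w h else 1) = (\<Prod>k\<in>{i, j}. w h)"
      using assms(1-3) by (intro prod.mono_neutral_cong_right) auto
    then show "(\<Prod>k\<in>S. \<Sum>h'\<in>H. u h k h') = w h * w h"
      using assms(4) by (simp add: sel)
  qed
  also have "\<dots> \<le> (\<Sum>h\<in>H. \<epsilon> * w h)"
    using w(1) by (intro sum_mono mult_right_mono) auto
  also have "\<dots> = \<epsilon>"
    using w(2) by (simp add: sum_distrib_left[symmetric])
  finally show ?thesis .
qed

section \<open>Binomial estimate and the final bound\<close>

text \<open>The term \<open>k ^ k / fact k\<close> of the exponential series at \<open>k\<close> is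
  at most \<open>exp k\<close>; combine this with
  \<open>(n choose k) * fact k \<le> n ^ k\<close>.\<close>

lemma binomial_le_exp_power:
  assumes "k > 0"
  shows "real (n choose k) \<le> (exp 1 * real n / real k) ^ k"
proof -
  have "(\<Sum>m\<in>{k}. inverse (fact m) * real k ^ m) \<le> (\<Sum>m. inverse (fact m) * real k ^ m)"
    by (intro sum_le_suminf summable_exp) auto
  also have "\<dots> = exp (real k)"
    by (simp add: exp_def)
  finally have exp: "real k ^ k \<le> exp 1 ^ k * fact k"
    by (simp add: exp_of_nat_mult[symmetric] field_simps)
  have "real (n choose k) * fact k \<le> real n ^ k"
    using binomial_fact_pow[of n k] by (metis of_nat_fact of_nat_le_iff of_nat_mult of_nat_power)
  then have "real (n choose k) * fact k * real k ^ k \<le> real n ^ k * (exp 1 ^ k * fact k)"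
    using exp by (intro mult_mono) auto
  then have "real (n choose k) * real k ^ k \<le> real n ^ k * exp 1 ^ k"
    by simp
  then show ?thesis
    using assms by (simp add: power_divide power_mult_distrib field_simps)
qed

text \<open>The random drawing itself: collisions have total probability at most 1/2 by
  \<open>large\<close>, so the union bound over the \<open>p choose q\<close> index sets must
  account for the remaining 1/2.\<close>

lemma matching_power_bound:
  fixes f :: "real set \<Rightarrow> real"
  assumes "q > 1" "finite H" "\<forall>h\<in>H. d_interval d h" "{} \<notin> H" "pq_property p q H"
    and f: "\<forall>h\<in>H. f h \<ge> 0" "\<forall>x. (\<Sum>h\<in>{h\<in>H. x \<in> h}. f h) \<le> 1"
    and large: "(\<Sum>h\<in>H. f h) > 2 * (real p)\<^sup>2"
  shows "(\<Sum>h\<in>H. f h) ^ (q - 1) \<le> 2 * real (p choose q) * real q * real d"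
proof -
  define T where "T = (\<Sum>h\<in>H. f h)"
  define w where "w h = f h / T" for h
  define S where "S = {..<p}"
  \<comment> \<open>Ordered pairs, at most \<open>p\<^sup>2\<close> of them, each colliding with
    probability at most \<open>1 / T\<close>; this is where the threshold
    \<open>2 * p\<^sup>2\<close> comes from.\<close>
  define D where "D = {(i, j). i \<in> S \<and> j \<in> S \<and> i \<noteq> j}"
  define \<Q> where "\<Q> = {Q. Q \<subseteq> S \<and> card Q = q}"
  define \<mu> where "\<mu> \<phi> = (\<Prod>i\<in>S. w (\<phi> i))" for \<phi> :: "nat \<Rightarrow> real set"
  have T: "T > 2 * (real p)\<^sup>2" "T > 0"
    using large unfolding T_def by (auto intro: le_less_trans[rotated])
  have finS: "finite S"
    by (simp add: S_def)
  have D: "finite D" "card D \<le> p\<^sup>2"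
  proof -
    have "D \<subseteq> S \<times> S"
      by (auto simp: D_def)
    then show "finite D" "card D \<le> p\<^sup>2"
      using finS card_mono[of "S \<times> S" D] finite_subset[of D "S \<times> S"]
      by (simp_all add: S_def power2_eq_square)
  qed
  have \<Q>: "finite \<Q>" "card \<Q> = p choose q"
    using finS n_subsets[OF finS, of q] by (simp_all add: \<Q>_def S_def)
  have w_star: "(\<Sum>h\<in>{h\<in>H. x \<in> h}. w h) \<le> 1 / T" for x
    using f(2) T(2) by (simp add: w_def sum_divide_distrib[symmetric] divide_right_mono)
  have w0: "w h \<ge> 0" if "h \<in> H" for h
    using f(1) T(2) that by (simp add: w_def)
  \<comment> \<open>A nonempty member weighs no more than all members through one of its
    points.\<close>
  have w_le: "w h \<le> 1 / T" if h: "h \<in> H" for h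
  proof -
    obtain x where "x \<in> h"
      using h assms(4) by (metis ex_in_conv)
    then have "w h \<le> (\<Sum>h\<in>{h\<in>H. x \<in> h}. w h)"
      using h w0 assms(2) by (intro member_le_sum) auto
    then show ?thesis
      using w_star[of x] by simp
  qed
  have w1: "(\<Sum>h\<in>H. w h) = 1"
    using T(2) by (simp add: w_def T_def sum_divide_distrib[symmetric])
  have \<mu>0: "\<mu> \<phi> \<ge> 0" if "\<phi> \<in> S \<rightarrow>\<^sub>E H" for \<phi>
    unfolding \<mu>_def using that by (intro prod_nonneg ballI w0) auto
  obtain L where L: "\<And>h. h \<in> H \<Longrightarrow> finite (L h) \<and> card (L h) \<le> d"
      "\<And>G. \<lbrakk>G \<subseteq> H; G \<noteq> {}; \<Inter>G \<noteq> {}\<rbrakk> \<Longrightarrow> \<exists>h\<in>G. \<exists>y\<in>L h. y \<in> \<Inter>G"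
    using d_intervals_meet_at_marked_point[OF assms(2,3)] by metis
  \<comment> \<open>Each tuple either repeats a value or has \<open>p\<close> distinct values,
    \<open>q\<close> of which meet. In the second case injectivity turns those \<open>q\<close>
    members into \<open>q\<close> indices.\<close>
  have cover: "\<mu> \<phi> \<le> (\<Sum>(i, j)\<in>D. of_bool (\<phi> i = \<phi> j) * \<mu> \<phi>) + (\<Sum>Q\<in>\<Q>. of_bool (\<Inter>(\<phi> ` Q) \<noteq> {}) * \<mu> \<phi>)"
    if \<phi>: "\<phi> \<in> S \<rightarrow>\<^sub>E H" for \<phi>
  proof (cases "inj_on \<phi> S")
    case False
    then obtain i j where "(i, j) \<in> D" "\<phi> i = \<phi> j"
      by (auto simp: inj_on_def D_def)
    then have "\<mu> \<phi> \<le> (\<Sum>(i, j)\<in>D. of_bool (\<phi> i = \<phi> j) * \<mu> \<phi>)"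
      using member_le_sum[of "(i, j)" D "\<lambda>(i, j). of_bool (\<phi> i = \<phi> j) * \<mu> \<phi>"] D(1) \<mu>0[OF \<phi>] by auto
    moreover have "(\<Sum>Q\<in>\<Q>. of_bool (\<Inter>(\<phi> ` Q) \<noteq> {}) * \<mu> \<phi>) \<ge> 0"
      using \<mu>0[OF \<phi>] by (simp add: sum_nonneg)
    ultimately show ?thesis
      by linarith
  next
    case True
    then have "card (\<phi> ` S) = p"
      by (simp add: card_image S_def)
    moreover have "\<phi> ` S \<subseteq> H"
      using \<phi> by auto
    ultimately obtain G where G: "G \<subseteq> \<phi> ` S" "card G = q" "\<Inter>G \<noteq> {}"
      using assms(5) finS unfolding pq_property_def by (metis finite_imageI)
    then obtain Q where Q: "Q \<subseteq> S" "G = \<phi> ` Q"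
      by (meson subset_imageE)
    then have "card Q = q"
      using G(2) True by (metis card_image inj_on_subset)
    then have "\<mu> \<phi> \<le> (\<Sum>Q\<in>\<Q>. of_bool (\<Inter>(\<phi> ` Q) \<noteq> {}) * \<mu> \<phi>)"
      using member_le_sum[of Q \<Q> "\<lambda>Q. of_bool (\<Inter>(\<phi> ` Q) \<noteq> {}) * \<mu> \<phi>"] \<Q>(1) \<mu>0[OF \<phi>] Q G(3)
      by (simp add: \<Q>_def)
    moreover have "(\<Sum>(i, j)\<in>D. of_bool (\<phi> i = \<phi> j) * \<mu> \<phi>) \<ge> 0"
      using \<mu>0[OF \<phi>] by (auto intro: sum_nonneg)
    ultimately show ?thesis
      by linarith
  qed
  have "1 = (\<Prod>i\<in>S. \<Sum>h\<in>H. w h)"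
    by (simp add: w1)
  also have "\<dots> = (\<Sum>\<phi>\<in>S \<rightarrow>\<^sub>E H. \<mu> \<phi>)"
    unfolding \<mu>_def using finS assms(2) by (intro prod_sum_PiE) auto
  also have "\<dots> \<le> (\<Sum>\<phi>\<in>S \<rightarrow>\<^sub>E H. (\<Sum>(i, j)\<in>D. of_bool (\<phi> i = \<phi> j) * \<mu> \<phi>)
      + (\<Sum>Q\<in>\<Q>. of_bool (\<Inter>(\<phi> ` Q) \<noteq> {}) * \<mu> \<phi>))"
    using cover by (rule sum_mono)
  also have "\<dots> = (\<Sum>(i, j)\<in>D. \<Sum>\<phi>\<in>S \<rightarrow>\<^sub>E H. of_bool (\<phi> i = \<phi> j) * \<mu> \<phi>)
      + (\<Sum>Q\<in>\<Q>. \<Sum>\<phi>\<in>S \<rightarrow>\<^sub>E H. of_bool (\<Inter>(\<phi> ` Q) \<noteq> {}) * \<mu> \<phi>)"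
    unfolding sum.distrib case_prod_unfold by (intro arg_cong2[where f = "(+)"] sum.swap)
  also have "\<dots> \<le> (\<Sum>(i, j)\<in>D. 1 / T) + (\<Sum>Q\<in>\<Q>. real q * real d * (1 / T) ^ (q - 1))"
  proof (intro add_mono sum_mono)
    show "(case ij of (i, j) \<Rightarrow> \<Sum>\<phi>\<in>S \<rightarrow>\<^sub>E H. of_bool (\<phi> i = \<phi> j) * \<mu> \<phi>)
        \<le> (case ij of (i, j) \<Rightarrow> 1 / T)" if ij: "ij \<in> D" for ij
    proof -
      obtain i j where "ij = (i, j)" "i \<in> S" "j \<in> S" "i \<noteq> j"
        using ij by (auto simp: D_def)
      then show ?thesis
        unfolding \<mu>_def using weight_of_collision[OF finS _ _ _ assms(2), of i j w "1 / T"] w0 w_le w1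
        by simp
    qed
    show "(\<Sum>\<phi>\<in>S \<rightarrow>\<^sub>E H. of_bool (\<Inter>(\<phi> ` Q) \<noteq> {}) * \<mu> \<phi>) \<le> real q * real d * (1 / T) ^ (q - 1)"
      if Q: "Q \<in> \<Q>" for Q
    proof -
      have "Q \<subseteq> S" "card Q = q" "Q \<noteq> {}"
        using Q assms(1) by (auto simp: \<Q>_def)
      then show ?thesis
        unfolding \<mu>_def
        using weight_of_intersecting_tuples[OF finS _ _ assms(2) w0 w1 w_star L, of Q] by simp
    qed
  qed
  also have "\<dots> = real (card D) / T + real (p choose q) * (real q * real d) / T ^ (q - 1)"
    using \<Q>(2) by (simp add: case_prod_unfold power_one_over divide_inverse power_inverse)
  finally have "1 \<le> real (card D) / T + real (p choose q) * (real q * real d) / T ^ (q - 1)" .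
  moreover have "real (card D) / T \<le> 1 / 2"
  proof -
    have "real (card D) \<le> (real p)\<^sup>2"
      using D(2) by (metis of_nat_le_iff of_nat_power)
    then have "2 * real (card D) \<le> T"
      using T(1) by linarith
    then show ?thesis
      using T(2) by (simp add: divide_le_eq)
  qed
  ultimately have "1 / 2 \<le> real (p choose q) * (real q * real d) / T ^ (q - 1)"
    by linarith
  then show ?thesis
    using T(2) unfolding T_def[symmetric] by (simp add: field_simps)
qed

theorem theorem3p1:
  fixes p q d :: nat and H :: "real set set"
  assumes "p \<ge> q" and "q > 1"
    and "finite H" and "\<forall>h\<in>H. d_interval d h"
    and "pq_property p q H"
  shows "tau_star H \<le>
    max (2 powr (1 / (real q - 1)) * (exp 1 * real p) powr (real q / (real q - 1)) / real q
           * real d powr (1 / (real q - 1)) + 1)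
        (2 * (real p)\<^sup>2)"
proof -
  define k where "k = q - 1"
  have k: "k > 0" "q = Suc k" "real q - 1 = real k"
    using assms(2) by (auto simp: k_def)
  define B where "B = 2 powr (1 / (real q - 1)) * (exp 1 * real p) powr (real q / (real q - 1)) / real q
           * real d powr (1 / (real q - 1))"
  have B0: "B \<ge> 0"
    by (simp add: B_def)
  have "(exp 1 * real p) powr real q = (exp 1 * real p) ^ q"
    using assms(1,2) by (simp add: powr_realpow)
  \<comment> \<open>For \<open>x = 0\<close> both sides vanish, since \<open>0 powr y = 0\<close>
    and \<open>k > 0\<close>.\<close>
  moreover have "(x powr (y / real k)) ^ k = x powr y" for x y :: real
    using k(1) by (cases "x = 0") (simp_all add: powr_power)
  ultimately have B_power: "B ^ k = 2 * (exp 1 * real p) ^ q / real q ^ k * real d"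
    unfolding B_def k(3) by (simp add: power_mult_distrib[of "_ powr _"] power_mult_distrib[of "_ * _"] power_mult_distrib[of "_ / _"] power_divide)
  have nonempty: "{} \<notin> H"
    using assms(4) by (auto simp: d_interval_def)
  have "(\<Sum>h\<in>H. f h) \<le> max (B + 1) (2 * (real p)\<^sup>2)"
    if f: "\<forall>h\<in>H. f h \<ge> 0" "\<forall>x. (\<Sum>h\<in>{h\<in>H. x \<in> h}. f h) \<le> 1" for f
  proof (rule ccontr)
    assume "\<not> (\<Sum>h\<in>H. f h) \<le> max (B + 1) (2 * (real p)\<^sup>2)"
    then have large: "(\<Sum>h\<in>H. f h) > B" "(\<Sum>h\<in>H. f h) > 2 * (real p)\<^sup>2"
      by auto
    have "(\<Sum>h\<in>H. f h) ^ k \<le> 2 * real (p choose q) * real q * real d"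
      using matching_power_bound[OF assms(2-4) nonempty assms(5) f large(2)] by (simp add: k_def)
    also have "\<dots> \<le> 2 * (exp 1 * real p / real q) ^ q * real q * real d"
      using binomial_le_exp_power[of q p] assms(2) by (intro mult_right_mono mult_left_mono) auto
    \<comment> \<open>The factor \<open>q\<close> cancels one of the \<open>q\<close> factors in the
      denominator \<open>q ^ q\<close>, leaving the \<open>q ^ k\<close> of
      \<open>B_power\<close>.\<close>
    also have "\<dots> = B ^ k"
      unfolding B_power using k(2) by (simp add: power_divide)
    finally show False
      using power_strict_mono[OF large(1) B0 k(1)] by linarith
  qed
  then show ?thesis
    unfolding B_def using tau_star_le_fractional_matching_bound[OF assms(3) nonempty] by blast
qed
end
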